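(* Let $G=(V,E)$ be a finite simple connected graph, let $M_G=(m_{vw})_{v,w\in V}\in\mathbb{R}^{V\times V}$ be a real symmetric matrix, and let $\Delta_G=\operatorname{diag}(f_v)_{v\in V}$ with $f_v\in\mathbb{R}\setminus\{0\}$ for all $v\in V$. Put $\mathcal{A}_G=\Delta_G+M_G$, and for $\mathbf{n}\in\mathbb{Z}_{>0}^V$ let $\mathcal{A}_{G[\mathbf{n}]}=\Delta_{G[\mathbf{n}]}+M_{G[\mathbf{n}]}$ be the associated matrix of the blowup $G[\mathbf{n}]$. (1) There exists a polynomial $p_{\mathcal{A}_G}:\mathbb{R}^V\to\mathbb{R}$ such that $$\det\mathcal{A}_{G[\mathbf{n}]}=\prod_{v\in V}f_v^{n_v-1}\cdot p_{\mathcal{A}_G}(\mathbf{n})\qquad\text{for all }\mathbf{n}\in\mathbb{Z}_{>0}^V.$$ This polynomial is unique, and is given by $$p_{\mathcal{A}_G}(\mathbf{n})=\det(\Delta_G+\Delta_{\mathbf{n}}M_G),\qquad \Delta_{\mathbf{n}}:=\operatorname{diag}(n_v)_{v\in V}.$$ In particular, $p_{\mathcal{A}_G}$ is multi-affine in $\mathbf{n}$, with constant term $p_{\mathcal{A}_G}(\mathbf{0})=\det\Delta_G=\prod_{v\in V}f_v$ and linear term $$(1,\dots,1)\cdot\Delta_{\mathbf{n}}\cdot\nabla p_{\mathcal{A}_G}(\mathbf{0})=p_{\mathcal{A}_G}(\mathbf{0})\sum_{v\in V}\frac{m_{vv}}{f_v}n_v.$$ (2) More generally, for each $I\subset V$ the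 coefficient in $p_{\mathcal{A}_G}(\mathbf{n})$ of $\prod_{v\in I}n_v$ equals $$\det(M_G)_{I\times I}\prod_{v\in V\setminus I}f_v .$$ (3) Given $\mathbf{n}\in\mathbb{Z}_{>0}^V$ and variables $\mathbf{t}=(t_{v,i})_{v\in V,\ 1\le i\le n_v}$ indexed by the vertices of $G[\mathbf{n}]$, define $n'_v:=\sum_{i=1}^{n_v}t_{v,i}$ and $\mathbf{n}':=(n'_v)_{v\in V}$. Then the blowup-polynomial of $G[\mathbf{n}]$ satisfies the polynomial identity $$p_{\mathcal{A}_{G[\mathbf{n}]}}(\mathbf{t})\equiv p_{\mathcal{A}_G}(\mathbf{n}')\prod_{v\in V}f_v^{n_v-1}.$$
   Context: For a finite simple graph $G=(V,E)$ and a tuple $\mathbf{n}=(n_v)_{v\in V}$ of positive integers, the $\mathbf{n}$-blowup $G[\mathbf{n}]$ is the graph with vertices $(v,i)$, $v\in V$, $1\le i\le n_v$ ($n_v$ copies of each vertex $v$), where $(v,i)$ and $(w,j)$ are adjacent if and only if $v\ne w$ are adjacent in $G$. The matrices attached to the blowup are as follows. $M_{G[\mathbf{n}]}$ is the block $V\times V$ matrix whose $(v,w)$ block is $m_{vw}\mathbf{1}_{n_v\times n_w}$ (with $\mathbf{1}$ the all-ones matrix). $\Delta_{G[\mathbf{n}]}$ is the block diagonal matrix whose $(v,v)$ block is $f_v\operatorname{Id}_{n_v}$. In part (3), $p_{\mathcal{A}_{G[\mathbf{n}]}}$ denotes the polynomial of part (1) for the graph $G[\mathbf{n}]$ and the matrices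 $M_{G[\mathbf{n}]},\Delta_{G[\mathbf{n}]}$ (in place of $G$, $M_G,\Delta_G$), in the variables indexed by the vertices of $G[\mathbf{n}]$. For $I\subset V$, $(M_G)_{I\times I}$ is the principal submatrix with rows and columns indexed by $I$; the determinant of the empty matrix is $1$. A polynomial is multi-affine if it has degree at most one in each variable. *)

theory Defs
  imports
    "HOL-Analysis.Analysis"
    "HOL-Library.Poly_Mapping"
    "Graph_Theory.Digraph_Component"
begin

subsection \<open>Matrices indexed by a finite set\<close>

text \<open>
  The vertex set of a blowup depends on the tuple \<open>n\<close>, so matrices are indexed by a finite set \<open>V\<close>
  rather than by a finite type. Entries outside \<open>V \<times> V\<close> are irrelevant; in particular
  \<open>det_on I A\<close> for \<open>I \<subseteq> V\<close> is the determinant of the principal submatrix of \<open>A\<close> on \<open>I\<close>.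
  The formula is that of \<^const>\<open>det\<close>.
\<close>

definition det_on :: "'i set \<Rightarrow> ('i \<Rightarrow> 'i \<Rightarrow> 'r::comm_ring_1) \<Rightarrow> 'r" where
  "det_on I A = (\<Sum>p\<in>{p. p permutes I}. of_int (sign p) * (\<Prod>i\<in>I. A i (p i)))"

lemma det_on_UNIV: "det_on UNIV (\<lambda>i j. A $ i $ j) = det A"
  by (simp add: det_on_def det_def)

lemma det_on_empty: "det_on {} A = 1"
  by (simp add: det_on_def)

definition diag_mat :: "('i \<Rightarrow> 'r::zero) \<Rightarrow> 'i \<Rightarrow> 'i \<Rightarrow> 'r" where
  "diag_mat d = (\<lambda>i j. if i = j then d i else 0)"

definition mat_plus :: "('i \<Rightarrow> 'i \<Rightarrow> 'r::plus) \<Rightarrow> ('i \<Rightarrow> 'i \<Rightarrow> 'r) \<Rightarrow> 'i \<Rightarrow> 'i \<Rightarrow> 'r" where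
  "mat_plus A B = (\<lambda>i j. A i j + B i j)"

definition mat_times ::
  "'i set \<Rightarrow> ('i \<Rightarrow> 'i \<Rightarrow> 'r::comm_semiring_0) \<Rightarrow> ('i \<Rightarrow> 'i \<Rightarrow> 'r) \<Rightarrow> 'i \<Rightarrow> 'i \<Rightarrow> 'r" where
  "mat_times V A B = (\<lambda>i j. \<Sum>k\<in>V. A i k * B k j)"


subsection \<open>Real multivariate polynomials\<close>

text \<open>
  A monomial is its finitely supported exponent vector, and a polynomial is its finitely supported
  coefficient function; the ring structure (convolution) is the one of \<^theory>\<open>HOL-Library.Poly_Mapping\<close>.
\<close>

type_synonym 'v mpoly = "('v \<Rightarrow>\<^sub>0 nat) \<Rightarrow>\<^sub>0 real"

definition PVar :: "'v \<Rightarrow> 'v mpoly" where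
  "PVar v = Poly_Mapping.single (Poly_Mapping.single v 1) 1"

definition PConst :: "real \<Rightarrow> 'v mpoly" where
  "PConst c = Poly_Mapping.single 0 c"

abbreviation coefficient :: "'v mpoly \<Rightarrow> ('v \<Rightarrow>\<^sub>0 nat) \<Rightarrow> real" where
  "coefficient p m \<equiv> Poly_Mapping.lookup p m"

definition squarefree_monomial :: "'v set \<Rightarrow> 'v \<Rightarrow>\<^sub>0 nat" where
  "squarefree_monomial I = (\<Sum>v\<in>I. Poly_Mapping.single v 1)"

definition polynomial_in :: "'v set \<Rightarrow> 'v mpoly \<Rightarrow> bool" where
  "polynomial_in V p \<longleftrightarrow> (\<forall>m\<in>Poly_Mapping.keys p. Poly_Mapping.keys m \<subseteq> V)"

definition multi_affine :: "'v mpoly \<Rightarrow> bool" where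
  "multi_affine p \<longleftrightarrow> (\<forall>m\<in>Poly_Mapping.keys p. \<forall>v. Poly_Mapping.lookup m v \<le> 1)"

text \<open>Evaluation in a commutative ring, with coefficients mapped there by \<open>h\<close>.\<close>

definition peval_via :: "(real \<Rightarrow> 'r::comm_ring_1) \<Rightarrow> ('v \<Rightarrow> 'r) \<Rightarrow> 'v mpoly \<Rightarrow> 'r" where
  "peval_via h x p = (\<Sum>m\<in>Poly_Mapping.keys p.
     h (Poly_Mapping.lookup p m) * (\<Prod>v\<in>Poly_Mapping.keys m. x v ^ Poly_Mapping.lookup m v))"

abbreviation peval :: "('v \<Rightarrow> real) \<Rightarrow> 'v mpoly \<Rightarrow> real" where
  "peval \<equiv> peval_via (\<lambda>c. c)"

abbreviation psubst :: "('v \<Rightarrow> 'w mpoly) \<Rightarrow> 'v mpoly \<Rightarrow> 'w mpoly" where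
  "psubst \<equiv> peval_via PConst"

definition homogeneous_part :: "nat \<Rightarrow> 'v mpoly \<Rightarrow> 'v mpoly" where
  "homogeneous_part d p =
    (\<Sum>m\<in>{m \<in> Poly_Mapping.keys p. (\<Sum>v\<in>Poly_Mapping.keys m. Poly_Mapping.lookup m v) = d}.
       Poly_Mapping.single m (Poly_Mapping.lookup p m))"

definition partial_deriv :: "'v \<Rightarrow> (('v \<Rightarrow> real) \<Rightarrow> real) \<Rightarrow> ('v \<Rightarrow> real) \<Rightarrow> real" where
  "partial_deriv v F x = deriv (\<lambda>s. F (x(v := s))) (x v)"


subsection \<open>Blowups\<close>

definition blowup :: "'a pair_pre_digraph \<Rightarrow> ('a \<Rightarrow> nat) \<Rightarrow> ('a \<times> nat) pair_pre_digraph" where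
  "blowup G n =
    \<lparr> pverts = (SIGMA v:pverts G. {1..n v}),
      parcs = {((v, i), (w, j)) | v i w j.
        (v, w) \<in> parcs G \<and> i \<in> {1..n v} \<and> j \<in> {1..n w}} \<rparr>"

lemma pair_graph_blowup:
  assumes "pair_graph G"
  shows "pair_graph (blowup G n)"
proof -
  interpret pair_graph G by fact
  have fin: "finite (pverts (blowup G n))"
    using pair_finite_verts by (simp add: blowup_def)
  have sub: "parcs (blowup G n) \<subseteq> pverts (blowup G n) \<times> pverts (blowup G n)"
    by (auto simp: blowup_def dest: in_arcsD1 in_arcsD2)
  have "finite (parcs (blowup G n))"
    by (rule finite_subset[OF sub]) (simp add: fin)
  moreover have "sym (parcs (blowup G n))"
    using pair_sym_arcs by (auto simp: blowup_def sym_def symmetric_def)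
  moreover have "fst e \<noteq> snd e" if "e \<in> parcs (blowup G n)" for e
    using that pair_no_loops by (fastforce simp: blowup_def)
  ultimately show ?thesis
    using fin sub by unfold_locales (auto simp: symmetric_def)
qed

text \<open>
  The data \<open>\<Delta>\<^sub>G = diag_mat f\<close> and \<open>M\<^sub>G = M\<close> attached to \<open>G\<close> determine those attached to \<open>G[n]\<close>:
  the diagonal of \<open>\<Delta>\<close> at \<open>(v, i)\<close> is \<open>f v\<close>, and the entry of \<open>M\<close> at \<open>(v, i), (w, j)\<close> is \<open>M v w\<close>.
\<close>

definition blowup_diag :: "('a \<Rightarrow> real) \<Rightarrow> 'a \<times> nat \<Rightarrow> real" where
  "blowup_diag f = (\<lambda>(v, i). f v)"

definition blowup_mat :: "('a \<Rightarrow> 'a \<Rightarrow> real) \<Rightarrow> 'a \<times> nat \<Rightarrow> 'a \<times> nat \<Rightarrow> real" where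
  "blowup_mat M = (\<lambda>(v, i) (w, j). M v w)"

definition A_mat :: "('i \<Rightarrow> real) \<Rightarrow> ('i \<Rightarrow> 'i \<Rightarrow> real) \<Rightarrow> 'i \<Rightarrow> 'i \<Rightarrow> real" where
  "A_mat f M = mat_plus (diag_mat f) M"

definition is_blowup_polynomial ::
  "'a pair_pre_digraph \<Rightarrow> ('a \<Rightarrow> real) \<Rightarrow> ('a \<Rightarrow> 'a \<Rightarrow> real) \<Rightarrow> 'a mpoly \<Rightarrow> bool" where
  "is_blowup_polynomial G f M p \<longleftrightarrow>
     polynomial_in (pverts G) p \<and>
     (\<forall>n. (\<forall>v\<in>pverts G. 0 < n v) \<longrightarrow>
        det_on (pverts (blowup G n)) (A_mat (blowup_diag f) (blowup_mat M)) =
          (\<Prod>v\<in>pverts G. f v ^ (n v - 1)) * peval (\<lambda>v. real (n v)) p)"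

definition blowup_polynomial ::
  "'a pair_pre_digraph \<Rightarrow> ('a \<Rightarrow> real) \<Rightarrow> ('a \<Rightarrow> 'a \<Rightarrow> real) \<Rightarrow> 'a mpoly" where
  "blowup_polynomial G f M = (THE p. is_blowup_polynomial G f M p)"

end

theory Submission
  imports Defs
begin

text \<open>
  The determinant of \<open>diag d + diag x \<cdot> A\<close> is the sum, over the subsets \<open>I\<close> of the index set, of
  the product of \<open>x\<close> over \<open>I\<close>, the principal minor of \<open>A\<close> on \<open>I\<close>, and the product of \<open>d\<close> over the
  complement of \<open>I\<close> (\<open>det_on_diag_plus_scaled\<close>). Over the polynomial ring, with variables for \<open>x\<close>,
  this shows that the polynomial \<open>det (\<Delta>\<^sub>G + \<Delta>\<^sub>n M\<^sub>G)\<close> is multi-affine and exhibits its coefficients,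
  among them the constant and the linear ones.

  Applied to a blowup, whose matrix entries only depend on the projections to \<open>V\<close>, the same expansion
  loses every subset that contains two copies of one vertex, because its minor has two equal rows.
  A remaining subset consists of one copy of each vertex of some \<open>I \<subseteq> V\<close>, and its minor is that of
  \<open>I\<close> itself. With a weight \<open>t\<close> on each vertex of the blowup, the sum over the choices of copies
  turns the product of \<open>t\<close> into the product over \<open>I\<close> of the fibre sums of \<open>t\<close>, which is again an
  expansion of the first kind, for \<open>V\<close> (\<open>det_on_blowup\<close>). This identity holds in every commutative
  ring. For \<open>t = 1\<close> the fibre sums are the sizes \<open>n v\<close>, which gives the determinant of the blowup; for
  polynomial variables \<open>t\<close> it is the formula for the blowup-polynomial of the blowup.

  Uniqueness, and with it the identification of the definite description, holds because a real
  polynomial is determined by its values at the positive integer points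
  (\<open>polynomial_eqI_positive_integers\<close>), and the prefactor in the determinant formula is nonzero.
\<close>

section \<open>Determinants over finite index sets\<close>

lemma det_on_cong:
  assumes "\<And>i j. i \<in> I \<Longrightarrow> j \<in> I \<Longrightarrow> A i j = B i j"
  shows "det_on I A = det_on I B"
  unfolding det_on_def
  by (intro sum.cong refl arg_cong2[of _ _ _ _ "(*)"] prod.cong)
     (auto simp: assms permutes_in_image)

text \<open>
  Conjugation by \<open>\<phi>\<close> is a sign-preserving bijection between the permutations of \<open>I\<close> and those of
  its image.
\<close>

lemma det_on_reindex:
  fixes A :: "'j \<Rightarrow> 'j \<Rightarrow> 'r::comm_ring_1"
  assumes inj: "inj_on \<phi> I" and fin: "finite I"
  shows "det_on (\<phi> ` I) A = det_on I (\<lambda>i j. A (\<phi> i) (\<phi> j))"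
proof -
  have bij: "bij_betw \<phi> I (\<phi> ` I)"
    using inj by (simp add: bij_betw_def)
  have perms: "bij_betw (map_permutation I \<phi>) {p. p permutes I} {q. q permutes \<phi> ` I}"
  proof (rule bij_betw_byWitness[where f' = "map_permutation (\<phi> ` I) (inv_into I \<phi>)"])
    show "\<forall>p\<in>{p. p permutes I}.
            map_permutation (\<phi> ` I) (inv_into I \<phi>) (map_permutation I \<phi> p) = p"
      using map_permutation_compose_inv[OF bij] inv_into_f_f[OF inj] by auto
    show "\<forall>q\<in>{q. q permutes \<phi> ` I}.
            map_permutation I \<phi> (map_permutation (\<phi> ` I) (inv_into I \<phi>) q) = q"
      using map_permutation_compose_inv[OF bij_betw_inv_into[OF bij]] f_inv_into_f[of _ \<phi> I]
      by auto
    show "map_permutation I \<phi> ` {p. p permutes I} \<subseteq> {q. q permutes \<phi> ` I}"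
      using map_permutation_permutes[OF bij] by auto
    show "map_permutation (\<phi> ` I) (inv_into I \<phi>) ` {q. q permutes \<phi> ` I} \<subseteq> {p. p permutes I}"
      using map_permutation_permutes[OF bij_betw_inv_into[OF bij]] by auto
  qed
  show ?thesis
    unfolding det_on_def
  proof (subst sum.reindex_bij_betw[OF perms, symmetric], intro sum.cong refl)
    fix p assume "p \<in> {p. p permutes I}"
    then have p: "p permutes I" by simp
    have "(\<Prod>j\<in>\<phi> ` I. A j (map_permutation I \<phi> p j)) = (\<Prod>i\<in>I. A (\<phi> i) (\<phi> (p i)))"
      using inj by (simp add: prod.reindex map_permutation_apply)
    then show "of_int (sign (map_permutation I \<phi> p)) *
        (\<Prod>j\<in>\<phi> ` I. A j (map_permutation I \<phi> p j)) =
        of_int (sign p) * (\<Prod>i\<in>I. A (\<phi> i) (\<phi> (p i)))"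
      using sign_map_permutation[OF inj p fin] by simp
  qed
qed

text \<open>
  Composing with the transposition of \<open>a\<close> and \<open>b\<close> matches the even permutations with the odd ones
  and preserves each product of entries. Matching the two halves, instead of concluding from
  \<open>det = - det\<close>, keeps the argument valid in characteristic two.
\<close>

lemma det_on_identical_rows:
  fixes A :: "'i \<Rightarrow> 'i \<Rightarrow> 'r::comm_ring_1"
  assumes fin: "finite I" and ab: "a \<in> I" "b \<in> I" "a \<noteq> b"
    and rows: "\<And>j. j \<in> I \<Longrightarrow> A a j = A b j"
  shows "det_on I A = 0"
proof -
  define \<tau> where "\<tau> = Transposition.transpose a b"
  define E where "E = {p. p permutes I \<and> evenperm p}"
  define O' where "O' = {p. p permutes I \<and> \<not> evenperm p}"
  have \<tau>: "\<tau> permutes I" "\<not> evenperm \<tau>" "\<tau> \<circ> \<tau> = id"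
    using ab by (auto simp: \<tau>_def permutes_swap_id evenperm_swap)
  have perm: "permutation p" if "p permutes I" for p
    using that fin by (rule permutes_imp_permutation[rotated])
  have bij: "bij_betw (\<lambda>p. p \<circ> \<tau>) E O'"
  proof (rule bij_betw_byWitness[where f' = "\<lambda>p. p \<circ> \<tau>"])
    show "\<forall>p\<in>E. p \<circ> \<tau> \<circ> \<tau> = p" "\<forall>p\<in>O'. p \<circ> \<tau> \<circ> \<tau> = p"
      using \<tau>(3) by (auto simp: comp_assoc)
    show "(\<lambda>p. p \<circ> \<tau>) ` E \<subseteq> O'" "(\<lambda>p. p \<circ> \<tau>) ` O' \<subseteq> E"
      using \<tau> perm by (auto simp: E_def O'_def evenperm_comp permutes_compose)
  qed
  have prod_eq: "(\<Prod>i\<in>I. A i ((p \<circ> \<tau>) i)) = (\<Prod>i\<in>I. A i (p i))" if p: "p permutes I" for p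
  proof -
    have "(\<Prod>i\<in>I. A i (p i)) = (\<Prod>i\<in>I. A (\<tau> i) (p (\<tau> i)))"
      using prod.permute[OF \<tau>(1), of "\<lambda>i. A i (p i)"] by (simp add: o_def)
    also have "\<dots> = (\<Prod>i\<in>I. A i (p (\<tau> i)))"
    proof (rule prod.cong[OF refl])
      fix i assume "i \<in> I"
      then have "p (\<tau> i) \<in> I"
        using p \<tau>(1) by (simp add: permutes_in_image)
      then show "A (\<tau> i) (p (\<tau> i)) = A i (p (\<tau> i))"
        using rows by (auto simp: \<tau>_def Transposition.transpose_def)
    qed
    finally show ?thesis by simp
  qed
  have split: "{p. p permutes I} = E \<union> O'" "E \<inter> O' = {}"
    by (auto simp: E_def O'_def)
  have finEO: "finite E" "finite O'"
    using finite_permutations[OF fin] split(1) by (metis finite_Un)+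
  have "det_on I A = (\<Sum>p\<in>E. \<Prod>i\<in>I. A i (p i)) + (\<Sum>p\<in>O'. - (\<Prod>i\<in>I. A i (p i)))"
    unfolding det_on_def split(1) sum.union_disjoint[OF finEO split(2)]
    by (intro arg_cong2[of _ _ _ _ "(+)"] sum.cong refl) (auto simp: E_def O'_def sign_def)
  also have "(\<Sum>p\<in>O'. - (\<Prod>i\<in>I. A i (p i))) = (\<Sum>p\<in>E. - (\<Prod>i\<in>I. A i (p i)))"
    unfolding sum.reindex_bij_betw[OF bij, symmetric]
    by (intro sum.cong refl arg_cong[of _ _ uminus] prod_eq) (auto simp: E_def)
  finally show ?thesis
    by (simp add: sum_negf)
qed

lemma det_on_scale_rows:
  "det_on I (\<lambda>i j. x i * A i j) = (\<Prod>i\<in>I. x i) * det_on I A"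
  by (simp add: det_on_def prod.distrib sum_distrib_left mult_ac)

text \<open>
  Multiplying out the product over the rows means choosing the set \<open>I\<close> of rows that contribute
  their entry of \<open>B\<close>. The other rows contribute a diagonal entry, so only the permutations that fix
  them survive, and these are the permutations of \<open>I\<close>.
\<close>

lemma det_on_diag_plus:
  fixes d :: "'i \<Rightarrow> 'r::comm_ring_1"
  assumes fin: "finite V"
  shows "det_on V (mat_plus (diag_mat d) B) =
    (\<Sum>I\<in>Pow V. det_on I B * (\<Prod>i\<in>V - I. d i))"
proof -
  let ?P = "{p. p permutes V}"
  let ?T = "\<lambda>p I. of_int (sign p) * ((\<Prod>i\<in>I. B i (p i)) * (\<Prod>i\<in>V - I. diag_mat d i (p i)))"
  have finP: "finite ?P"
    using finite_permutations[OF fin] .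
  have "det_on V (mat_plus (diag_mat d) B) = (\<Sum>p\<in>?P. \<Sum>I\<in>Pow V. ?T p I)"
    unfolding det_on_def
    by (simp add: mat_plus_def add.commute[of "diag_mat _ _ _"] prod_add[OF fin] sum_distrib_left)
  also have "\<dots> = (\<Sum>I\<in>Pow V. \<Sum>p\<in>?P. ?T p I)"
    by (rule sum.swap)
  also have "\<dots> = (\<Sum>I\<in>Pow V. det_on I B * (\<Prod>i\<in>V - I. d i))"
  proof (rule sum.cong[OF refl])
    fix I assume "I \<in> Pow V"
    then have I: "I \<subseteq> V" by simp
    have "(\<Sum>p\<in>?P. ?T p I) = (\<Sum>p\<in>{p. p permutes I}. ?T p I)"
    proof (rule sum.mono_neutral_right[OF finP])
      show "{p. p permutes I} \<subseteq> ?P"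
        using I permutes_subset by blast
      show "\<forall>p\<in>?P - {p. p permutes I}. ?T p I = 0"
      proof
        fix p assume p: "p \<in> ?P - {p. p permutes I}"
        then obtain i where "i \<in> V - I" "p i \<noteq> i"
          using permutes_superset[of p V I] by auto
        then have "(\<Prod>i\<in>V - I. diag_mat d i (p i)) = 0"
          using fin by (intro prod_zero bexI[of _ i]) (auto simp: diag_mat_def)
        then show "?T p I = 0" by simp
      qed
    qed
    also have "\<dots> = (\<Sum>p\<in>{p. p permutes I}.
        (of_int (sign p) * (\<Prod>i\<in>I. B i (p i))) * (\<Prod>i\<in>V - I. d i))"
    proof (rule sum.cong[OF refl])
      fix p assume "p \<in> {p. p permutes I}"
      then have "(\<Prod>i\<in>V - I. diag_mat d i (p i)) = (\<Prod>i\<in>V - I. d i)"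
        by (intro prod.cong refl) (auto simp: diag_mat_def permutes_not_in)
      then show "?T p I = (of_int (sign p) * (\<Prod>i\<in>I. B i (p i))) * (\<Prod>i\<in>V - I. d i)"
        by (simp add: mult_ac)
    qed
    also have "\<dots> = det_on I B * (\<Prod>i\<in>V - I. d i)"
      by (simp add: det_on_def sum_distrib_right)
    finally show "(\<Sum>p\<in>?P. ?T p I) = det_on I B * (\<Prod>i\<in>V - I. d i)" .
  qed
  finally show ?thesis .
qed

lemma det_on_diag_mat:
  fixes d :: "'i \<Rightarrow> 'r::comm_ring_1"
  assumes "finite V"
  shows "det_on V (diag_mat d) = (\<Prod>i\<in>V. d i)"
proof -
  have "det_on V (diag_mat d) =
      (\<Sum>I\<in>Pow V. det_on I (\<lambda>_ _. 0 :: 'r) * (\<Prod>i\<in>V - I. d i))"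
    using det_on_diag_plus[OF assms, of d "\<lambda>_ _. 0"] by (simp add: mat_plus_def)
  also have "\<dots> = (\<Sum>I\<in>{{}}. det_on I (\<lambda>_ _. 0 :: 'r) * (\<Prod>i\<in>V - I. d i))"
  proof (rule sum.mono_neutral_right)
    show "\<forall>I\<in>Pow V - {{}}. det_on I (\<lambda>_ _. 0 :: 'r) * (\<Prod>i\<in>V - I. d i) = 0"
    proof
      fix I assume I: "I \<in> Pow V - {{}}"
      then have "finite I" "I \<noteq> {}"
        using assms finite_subset by auto
      then show "det_on I (\<lambda>_ _. 0 :: 'r) * (\<Prod>i\<in>V - I. d i) = 0"
        by (simp add: det_on_def power_0_left)
    qed
  qed (use assms in auto)
  finally show ?thesis
    by (simp add: det_on_empty)
qed

lemma mat_times_diag_mat: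
  fixes x :: "'i \<Rightarrow> 'r::comm_semiring_1"
  assumes "finite V" "i \<in> V"
  shows "mat_times V (diag_mat x) A i j = x i * A i j"
proof -
  have "mat_times V (diag_mat x) A i j = (\<Sum>k\<in>V. if i = k then x i * A k j else 0)"
    unfolding mat_times_def diag_mat_def by (intro sum.cong) auto
  then show ?thesis
    using assms by (simp add: sum.delta')
qed

text \<open>The coefficients of the blowup-polynomial can be read off from this expansion.\<close>

lemma det_on_diag_plus_scaled:
  fixes d x :: "'i \<Rightarrow> 'r::comm_ring_1"
  assumes fin: "finite V"
  shows "det_on V (mat_plus (diag_mat d) (mat_times V (diag_mat x) A)) =
    (\<Sum>I\<in>Pow V. (\<Prod>i\<in>I. x i) * (det_on I A * (\<Prod>i\<in>V - I. d i)))"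
proof -
  have "det_on V (mat_plus (diag_mat d) (mat_times V (diag_mat x) A)) =
      det_on V (mat_plus (diag_mat d) (\<lambda>i j. x i * A i j))"
    by (rule det_on_cong) (simp add: mat_plus_def mat_times_diag_mat[OF fin])
  then show ?thesis
    by (simp add: det_on_diag_plus[OF fin] det_on_scale_rows mult.assoc)
qed


section \<open>Determinants of blowups\<close>

text \<open>
  A subset of the blowup on which the projection is injective is the graph of a function on its
  image, so these subsets correspond to pairs of a subset \<open>I\<close> and a choice of one copy over each
  vertex of \<open>I\<close>.
\<close>

lemma sum_subsets_blowup:
  fixes F :: "('a \<times> nat) set \<Rightarrow> 'r::comm_monoid_add"
  assumes fin: "finite V"
    and zero: "\<And>J. J \<subseteq> (SIGMA v:V. B v) \<Longrightarrow> \<not> inj_on fst J \<Longrightarrow> F J = 0"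
    and finB: "\<And>v. v \<in> V \<Longrightarrow> finite (B v)"
  shows "(\<Sum>J\<in>Pow (SIGMA v:V. B v). F J) =
    (\<Sum>I\<in>Pow V. \<Sum>g\<in>Pi\<^sub>E I B. F ((\<lambda>v. (v, g v)) ` I))"
proof -
  let ?W = "SIGMA v:V. B v"
  let ?D = "SIGMA I:Pow V. Pi\<^sub>E I B"
  let ?graph = "\<lambda>(I, g). (\<lambda>v. (v, g v)) ` I"
  have finW: "finite ?W"
    using fin finB by blast
  have inj: "inj_on ?graph ?D"
  proof (rule inj_onI, clarify)
    fix I g I' g'
    assume g: "g \<in> Pi\<^sub>E I B" and g': "g' \<in> Pi\<^sub>E I' B"
      and eq: "(\<lambda>v. (v, g v)) ` I = (\<lambda>v. (v, g' v)) ` I'"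
    have "fst ` (\<lambda>v. (v, g v)) ` I = fst ` (\<lambda>v. (v, g' v)) ` I'"
      using eq by simp
    then have I: "I = I'"
      by (simp add: image_image)
    moreover have "g v = g' v" if "v \<in> I" for v
      using that eq by auto
    ultimately show "I = I' \<and> g = g'"
      using PiE_ext[OF g] g' by blast
  qed
  have image: "?graph ` ?D = {J \<in> Pow ?W. inj_on fst J}"
  proof (intro equalityI subsetI)
    fix J assume "J \<in> ?graph ` ?D"
    then show "J \<in> {J \<in> Pow ?W. inj_on fst J}"
      by (fastforce simp: inj_on_def PiE_iff)
  next
    fix J assume "J \<in> {J \<in> Pow ?W. inj_on fst J}"
    then have J: "J \<subseteq> ?W" "inj_on fst J" by auto
    define g where "g = (\<lambda>v\<in>fst ` J. snd (inv_into J fst v))"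
    have g: "g v = i" if "(v, i) \<in> J" for v i
    proof -
      have "inv_into J fst (fst (v, i)) = (v, i)"
        using J(2) that by (rule inv_into_f_f)
      moreover have "v \<in> fst ` J"
        using that by force
      ultimately show ?thesis
        by (simp add: g_def)
    qed
    have "g \<in> Pi\<^sub>E (fst ` J) B"
    proof (rule PiE_I)
      fix v assume "v \<in> fst ` J"
      then obtain i where "(v, i) \<in> J" by auto
      then show "g v \<in> B v"
        using g J(1) by auto
    qed (simp add: g_def)
    moreover have "J = (\<lambda>v. (v, g v)) ` fst ` J"
      using g by (force simp: image_image)
    moreover have "fst ` J \<in> Pow V"
      using J(1) by auto
    ultimately show "J \<in> ?graph ` ?D"
      by (intro image_eqI[of _ _ "(fst ` J, g)"]) auto
  qed
  have "(\<Sum>J\<in>Pow ?W. F J) = (\<Sum>J\<in>{J \<in> Pow ?W. inj_on fst J}. F J)"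
    using finW zero by (intro sum.mono_neutral_right) auto
  also have "\<dots> = (\<Sum>(I, g)\<in>?D. F ((\<lambda>v. (v, g v)) ` I))"
    unfolding image[symmetric] sum.reindex[OF inj] by (simp add: case_prod_unfold)
  also have "\<dots> = (\<Sum>I\<in>Pow V. \<Sum>g\<in>Pi\<^sub>E I B. F ((\<lambda>v. (v, g v)) ` I))"
    using fin finB by (intro sum.Sigma[symmetric] ballI finite_PiE) (auto intro: finite_subset)
  finally show ?thesis .
qed

text \<open>
  Each fibre keeps \<open>n v - 1\<close> of its copies if \<open>v \<in> I\<close> and all \<open>n v\<close> otherwise; positivity of \<open>n v\<close>
  makes the truncated exponent \<open>n v - 1\<close> honest.
\<close>

lemma prod_blowup_minus_section:
  fixes d :: "'a \<Rightarrow> 'r::comm_monoid_mult"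
  assumes fin: "finite V" and pos: "\<And>v. v \<in> V \<Longrightarrow> 0 < n v"
    and I: "I \<subseteq> V" and g: "g \<in> Pi\<^sub>E I (\<lambda>v. {1..n v})"
  shows "(\<Prod>u\<in>(SIGMA v:V. {1..n v}) - (\<lambda>v. (v, g v)) ` I. d (fst u)) =
    (\<Prod>v\<in>V. d v ^ (n v - 1)) * (\<Prod>v\<in>V - I. d v)"
proof -
  define B where "B v = {1..n v} - (if v \<in> I then {g v} else {})" for v
  have finB: "finite (B v)" for v
    by (simp add: B_def)
  have "(SIGMA v:V. {1..n v}) - (\<lambda>v. (v, g v)) ` I = (SIGMA v:V. B v)"
    using I by (auto simp: B_def split: if_splits)
  then have "(\<Prod>u\<in>(SIGMA v:V. {1..n v}) - (\<lambda>v. (v, g v)) ` I. d (fst u)) =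
      (\<Prod>v\<in>V. \<Prod>i\<in>B v. d v)"
    using fin finB by (simp add: prod.Sigma case_prod_unfold del: prod_constant)
  also have "\<dots> = (\<Prod>v\<in>V. d v ^ (n v - 1) * (if v \<in> V - I then d v else 1))"
  proof (rule prod.cong[OF refl])
    fix v assume v: "v \<in> V"
    have "card (B v) = n v - (if v \<in> I then 1 else 0)"
      using g by (auto simp: B_def PiE_iff Pi_iff)
    moreover have "d v ^ n v = d v ^ (n v - 1) * d v"
      using pos[OF v] by (metis power_minus_mult)
    ultimately show "(\<Prod>i\<in>B v. d v) = d v ^ (n v - 1) * (if v \<in> V - I then d v else 1)"
      using v by simp
  qed
  also have "\<dots> = (\<Prod>v\<in>V. d v ^ (n v - 1)) * (\<Prod>v\<in>V - I. d v)"
    using fin by (simp add: prod.distrib prod.If_cases set_diff_eq Int_def)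
  finally show ?thesis .
qed

text \<open>
  In the principal minor expansion of the left-hand side, a subset that contains two copies of one
  vertex contributes nothing, because its minor has two equal rows. The remaining subsets are
  sections over some \<open>I \<subseteq> V\<close>, they share the minor of \<open>A\<close> on \<open>I\<close>, and summing their products of
  \<open>t\<close> gives the product over \<open>I\<close> of the sums of \<open>t\<close> over the copies. The ring is arbitrary, so that
  the identity serves both for numbers and for polynomial variables \<open>t\<close>.
\<close>

lemma det_on_blowup:
  fixes d :: "'a \<Rightarrow> 'r::comm_ring_1"
  assumes fin: "finite V" and pos: "\<And>v. v \<in> V \<Longrightarrow> 0 < n v"
  defines "W \<equiv> (SIGMA v:V. {1..n v})"
  shows "det_on W (mat_plus (diag_mat (\<lambda>u. d (fst u)))
           (mat_times W (diag_mat t) (\<lambda>u w. A (fst u) (fst w)))) =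
    (\<Prod>v\<in>V. d v ^ (n v - 1)) *
      det_on V (mat_plus (diag_mat d)
        (mat_times V (diag_mat (\<lambda>v. \<Sum>i=1..n v. t (v, i))) A))"
    (is "?L = ?c * ?R")
proof -
  define A' where "A' = (\<lambda>(u :: 'a \<times> nat) (w :: 'a \<times> nat). A (fst u) (fst w))"
  have finW: "finite W"
    using fin by (simp add: W_def)
  have "?L = (\<Sum>J\<in>Pow W. (\<Prod>u\<in>J. t u) * (det_on J A' * (\<Prod>u\<in>W - J. d (fst u))))"
    unfolding det_on_diag_plus_scaled[OF finW] A'_def ..
  also have "\<dots> = (\<Sum>I\<in>Pow V. \<Sum>g\<in>Pi\<^sub>E I (\<lambda>v. {1..n v}).
      (\<Prod>u\<in>(\<lambda>v. (v, g v)) ` I. t u) *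
      (det_on ((\<lambda>v. (v, g v)) ` I) A' * (\<Prod>u\<in>W - (\<lambda>v. (v, g v)) ` I. d (fst u))))"
    unfolding W_def
  proof (rule sum_subsets_blowup[OF fin])
    fix J assume J: "J \<subseteq> (SIGMA v:V. {1..n v})" "\<not> inj_on fst J"
    then obtain u w where uw: "u \<in> J" "w \<in> J" "u \<noteq> w" "fst u = fst w"
      by (auto simp: inj_on_def)
    have "finite J"
      using J(1) finW finite_subset unfolding W_def by blast
    then have "det_on J A' = 0"
      using uw(1-3) by (rule det_on_identical_rows) (simp add: A'_def uw(4))
    then show "(\<Prod>u\<in>J. t u) *
        (det_on J A' * (\<Prod>u\<in>(SIGMA v:V. {1..n v}) - J. d (fst u))) = 0"
      by simp
  qed simp
  also have "\<dots> = (\<Sum>I\<in>Pow V. \<Sum>g\<in>Pi\<^sub>E I (\<lambda>v. {1..n v}).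
      (\<Prod>v\<in>I. t (v, g v)) * (det_on I A * (?c * (\<Prod>v\<in>V - I. d v))))"
  proof (intro sum.cong refl)
    fix I g assume "I \<in> Pow V" and g: "g \<in> Pi\<^sub>E I (\<lambda>v. {1..n v})"
    then have I: "I \<subseteq> V" "finite I"
      using fin finite_subset by auto
    have inj: "inj_on (\<lambda>v. (v, g v)) I"
      by (simp add: inj_on_def)
    have "(\<Prod>u\<in>W - (\<lambda>v. (v, g v)) ` I. d (fst u)) = ?c * (\<Prod>v\<in>V - I. d v)"
      unfolding W_def using fin pos I(1) g by (rule prod_blowup_minus_section)
    moreover have "det_on ((\<lambda>v. (v, g v)) ` I) A' = det_on I A"
      by (simp add: det_on_reindex[OF inj I(2)] A'_def)
    ultimately show "(\<Prod>u\<in>(\<lambda>v. (v, g v)) ` I. t u) *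
        (det_on ((\<lambda>v. (v, g v)) ` I) A' * (\<Prod>u\<in>W - (\<lambda>v. (v, g v)) ` I. d (fst u))) =
        (\<Prod>v\<in>I. t (v, g v)) * (det_on I A * (?c * (\<Prod>v\<in>V - I. d v)))"
      by (simp add: prod.reindex[OF inj])
  qed
  also have "\<dots> = (\<Sum>I\<in>Pow V. (\<Prod>v\<in>I. \<Sum>i=1..n v. t (v, i)) *
      (det_on I A * (?c * (\<Prod>v\<in>V - I. d v))))"
    using fin by (intro sum.cong refl)
      (subst prod_sum_PiE, auto simp: sum_distrib_right intro: finite_subset)
  also have "\<dots> = ?c * ?R"
    unfolding det_on_diag_plus_scaled[OF fin] by (simp add: sum_distrib_left mult_ac)
  finally show ?thesis .
qed


section \<open>Polynomials and their evaluation\<close>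

text \<open>
  The homomorphism \<open>h\<close> is the identity for evaluation and the embedding of constants for
  substitution, so that both are treated at once.
\<close>

locale real_ring_hom =
  fixes h :: "real \<Rightarrow> 'r::comm_ring_1"
  assumes hom_add: "h (a + b) = h a + h b"
    and hom_mult: "h (a * b) = h a * h b"
    and hom_one: "h 1 = 1"
begin

lemma hom_zero: "h 0 = 0"
  using hom_add[of 0 0] by simp

lemma hom_uminus: "h (- a) = - h a"
  using hom_add[of a "- a"] by (simp add: hom_zero eq_neg_iff_add_eq_0 add.commute)

lemma hom_sum: "h (\<Sum>i\<in>S. a i) = (\<Sum>i\<in>S. h (a i))"
  by (induction S rule: infinite_finite_induct) (simp_all add: hom_zero hom_add)

lemma hom_prod: "h (\<Prod>i\<in>S. a i) = (\<Prod>i\<in>S. h (a i))"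
  by (induction S rule: infinite_finite_induct) (simp_all add: hom_one hom_mult)

lemma hom_power: "h (a ^ k) = h a ^ k"
  by (induction k) (simp_all add: hom_one hom_mult)

lemma hom_sign: "h (of_int (sign p)) = of_int (sign p)"
  by (simp add: sign_def hom_one hom_uminus)

lemma hom_det_on: "h (det_on I A) = det_on I (\<lambda>i j. h (A i j))"
  by (simp add: det_on_def hom_sum hom_mult hom_prod hom_sign)

text \<open>
  Summing over a larger set of monomials gives polynomials with different supports a common index
  set.
\<close>

lemma peval_via_superset:
  assumes "finite S" "Poly_Mapping.keys p \<subseteq> S"
  shows "peval_via h x p = (\<Sum>m\<in>S. h (Poly_Mapping.lookup p m) *
    (\<Prod>v\<in>Poly_Mapping.keys m. x v ^ Poly_Mapping.lookup m v))"
  unfolding peval_via_def using assms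
  by (intro sum.mono_neutral_left) (auto simp: in_keys_iff hom_zero)

lemma peval_via_add: "peval_via h x (p + q) = peval_via h x p + peval_via h x q"
proof -
  let ?S = "Poly_Mapping.keys p \<union> Poly_Mapping.keys q"
  have "Poly_Mapping.keys (p + q) \<subseteq> ?S"
    by (rule Poly_Mapping.keys_add)
  then show ?thesis
    by (simp add: peval_via_superset[of ?S] lookup_add hom_add distrib_right sum.distrib)
qed

lemma peval_via_sum: "peval_via h x (\<Sum>i\<in>S. p i) = (\<Sum>i\<in>S. peval_via h x (p i))"
proof (induction S rule: infinite_finite_induct)
  case empty
  show ?case by (simp add: peval_via_def)
next
  case (infinite S)
  then show ?case by (simp add: peval_via_def)
qed (simp add: peval_via_add)

lemma peval_via_single:
  "peval_via h x (Poly_Mapping.single m c) =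
    h c * (\<Prod>v\<in>Poly_Mapping.keys m. x v ^ Poly_Mapping.lookup m v)"
  by (subst peval_via_superset[of "{m}"]) (auto simp: lookup_single)

end

interpretation id_hom: real_ring_hom "\<lambda>c. c"
  by unfold_locales simp_all

interpretation PConst_hom: real_ring_hom PConst
  by unfold_locales (simp_all add: PConst_def single_add mult_single)

lemma lookup_squarefree_monomial:
  assumes "finite I"
  shows "Poly_Mapping.lookup (squarefree_monomial I) v = (if v \<in> I then 1 else 0)"
proof -
  have "Poly_Mapping.lookup (squarefree_monomial I) v = (\<Sum>w\<in>I. if w = v then 1 else 0)"
    unfolding squarefree_monomial_def lookup_sum by (intro sum.cong) (auto simp: lookup_single)
  then show ?thesis
    using assms by simp
qed

lemma keys_squarefree_monomial:
  "finite I \<Longrightarrow> Poly_Mapping.keys (squarefree_monomial I) = I"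
  by (auto simp: in_keys_iff lookup_squarefree_monomial split: if_splits)

lemma squarefree_monomial_eq_iff:
  "finite I \<Longrightarrow> finite J \<Longrightarrow> squarefree_monomial I = squarefree_monomial J \<longleftrightarrow> I = J"
  by (metis keys_squarefree_monomial)

lemma prod_PVar: "(\<Prod>v\<in>I. PVar v) = Poly_Mapping.single (squarefree_monomial I) 1"
  by (induction I rule: infinite_finite_induct)
     (simp_all add: squarefree_monomial_def PVar_def mult_single)

lemma degree_squarefree_monomial:
  "finite I \<Longrightarrow> (\<Sum>v\<in>Poly_Mapping.keys (squarefree_monomial I).
     Poly_Mapping.lookup (squarefree_monomial I) v) = card I"
  by (simp add: keys_squarefree_monomial lookup_squarefree_monomial)


section \<open>A polynomial is determined by its values at positive integers\<close>

lemma sum_power_eq_0_imp_coeffs_eq_0: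
  fixes c :: "nat \<Rightarrow> real"
  assumes zero: "\<And>k. k > 0 \<Longrightarrow> (\<Sum>i\<le>N. c i * real k ^ i) = 0" and "i \<le> N"
  shows "c i = 0"
proof (rule ccontr)
  assume "c i \<noteq> 0"
  then have "finite {z. (\<Sum>i\<le>N. c i * z ^ i) = 0}"
    using polyfun_finite_roots[where c = c and n = N] \<open>i \<le> N\<close> by auto
  moreover have "real ` {0<..} \<subseteq> {z. (\<Sum>i\<le>N. c i * z ^ i) = 0}"
    using zero by auto
  ultimately have "finite (real ` {0<..})"
    by (rule finite_subset[rotated])
  then have "finite ({0<..} :: nat set)"
    by (simp add: finite_image_iff inj_on_def)
  then show False
    by (simp add: infinite_Ioi)
qed

text \<open>
  Induction on the variables: for fixed values of the other variables, the sum is a polynomial in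
  \<open>x a\<close> with infinitely many roots, so the part with a fixed exponent of \<open>a\<close> vanishes. The exponent
  vectors in that part are told apart by the remaining variables, which is why the hypothesis
  speaks of injectivity of the restriction to the current set of variables.
\<close>

lemma sum_monomials_eq_0_imp_coeffs_eq_0:
  fixes c :: "('v \<Rightarrow> nat) \<Rightarrow> real"
  assumes "finite V" "finite S" "inj_on (\<lambda>e. restrict e V) S"
    and "\<And>x :: 'v \<Rightarrow> nat. (\<And>v. 0 < x v) \<Longrightarrow> (\<Sum>e\<in>S. c e * (\<Prod>v\<in>V. real (x v) ^ e v)) = 0"
    and "e \<in> S"
  shows "c e = 0"
  using assms
proof (induction V arbitrary: S e rule: finite_induct)
  case empty
  have "S = {e}"
    using empty.prems(2,4) by (auto simp: inj_on_def)
  then show ?case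
    using empty.prems(3)[of "\<lambda>_. 1"] by simp
next
  case (insert a V)
  define S' where "S' k = {e \<in> S. e a = k}" for k
  define N where "N = Max ((\<lambda>e. e a) ` S)"
  have N: "e a \<le> N" if "e \<in> S" for e
    using that insert.prems(1) by (simp add: N_def)
  have part_zero: "(\<Sum>e\<in>S' k. c e * (\<Prod>v\<in>V. real (x v) ^ e v)) = 0"
    if x: "\<And>v. 0 < x v" and k: "k \<le> N" for x :: "'v \<Rightarrow> nat" and k
  proof (rule sum_power_eq_0_imp_coeffs_eq_0[OF _ k])
    fix y :: nat assume y: "y > 0"
    have monomial: "(\<Prod>v\<in>insert a V. real ((x(a := y)) v) ^ e v) =
        (\<Prod>v\<in>V. real (x v) ^ e v) * real y ^ e a" for e
    proof -
      have "(\<Prod>v\<in>V. real ((x(a := y)) v) ^ e v) = (\<Prod>v\<in>V. real (x v) ^ e v)"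
        using insert.hyps(2) by (intro prod.cong) auto
      then show ?thesis
        using insert.hyps by (simp add: mult.commute)
    qed
    have "(\<Sum>k\<le>N. (\<Sum>e\<in>S' k. c e * (\<Prod>v\<in>V. real (x v) ^ e v)) * real y ^ k) =
        (\<Sum>k\<le>N. \<Sum>e\<in>S' k. c e * ((\<Prod>v\<in>V. real (x v) ^ e v) * real y ^ e a))"
      by (simp add: sum_distrib_right S'_def mult.assoc)
    also have "\<dots> = (\<Sum>e\<in>S. c e * ((\<Prod>v\<in>V. real (x v) ^ e v) * real y ^ e a))"
      unfolding S'_def using N insert.prems(1) by (intro sum.group) auto
    also have "\<dots> = (\<Sum>e\<in>S. c e * (\<Prod>v\<in>insert a V. real ((x(a := y)) v) ^ e v))"
      by (simp only: monomial)
    also have "\<dots> = 0"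
      using x y by (intro insert.prems(3)) auto
    finally show "(\<Sum>k\<le>N. (\<Sum>e\<in>S' k. c e * (\<Prod>v\<in>V. real (x v) ^ e v)) * real y ^ k) = 0" .
  qed
  have inj: "inj_on (\<lambda>e. restrict e V) (S' (e a))"
  proof (rule inj_onI)
    fix e1 e2 assume e12: "e1 \<in> S' (e a)" "e2 \<in> S' (e a)" "restrict e1 V = restrict e2 V"
    then have "restrict e1 (insert a V) = restrict e2 (insert a V)"
      by (auto simp: S'_def restrict_def fun_eq_iff) metis
    then show "e1 = e2"
      using inj_onD[OF insert.prems(2), of e1 e2] e12(1,2) by (simp add: S'_def)
  qed
  show ?case
  proof (rule insert.IH[of "S' (e a)"])
    show "finite (S' (e a))" "e \<in> S' (e a)"
      using insert.prems(1,4) by (auto simp: S'_def)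
    show "(\<Sum>e\<in>S' (e a). c e * (\<Prod>v\<in>V. real (x v) ^ e v)) = 0"
      if "\<And>v. 0 < x v" for x :: "'v \<Rightarrow> nat"
      using that N[OF insert.prems(4)] by (rule part_zero)
  qed (rule inj)
qed

text \<open>
  The difference of the two polynomials satisfies the hypothesis of the previous lemma once its
  exponent vectors are turned into functions; the restriction to \<open>V\<close> is injective on them because
  all other exponents are zero.
\<close>

lemma polynomial_eqI_positive_integers:
  assumes fin: "finite V" and p: "polynomial_in V p" and q: "polynomial_in V q"
    and eq: "\<And>x :: 'v \<Rightarrow> nat. (\<And>v. 0 < x v) \<Longrightarrow>
      peval (\<lambda>v. real (x v)) p = peval (\<lambda>v. real (x v)) q"
  shows "p = q"
proof (rule poly_mapping_eqI)
  fix m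
  define S where "S = Poly_Mapping.keys p \<union> Poly_Mapping.keys q"
  (* L forgets that exponent vectors have finite support *)
  define L where "L = (Poly_Mapping.lookup :: ('v \<Rightarrow>\<^sub>0 nat) \<Rightarrow> 'v \<Rightarrow> nat)"
  define c where "c m = Poly_Mapping.lookup p m - Poly_Mapping.lookup q m" for m
  have S: "finite S" "Poly_Mapping.keys p \<subseteq> S" "Poly_Mapping.keys q \<subseteq> S"
    by (auto simp: S_def)
  have keys: "Poly_Mapping.keys m \<subseteq> V" if "m \<in> S" for m
    using that p q by (auto simp: S_def polynomial_in_def)
  have injL: "inj L"
    by (auto simp: L_def inj_def poly_mapping_eqI)
  have c: "c m = 0" if "m \<in> S" for m
  proof -
    have "(\<lambda>e. c (inv L e)) (L m) = 0"
    proof (rule sum_monomials_eq_0_imp_coeffs_eq_0[OF fin])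
      show "finite (L ` S)" "L m \<in> L ` S"
        using S(1) that by auto
      show "inj_on (\<lambda>e. restrict e V) (L ` S)"
      proof (rule inj_onI, clarify)
        fix m1 m2 assume m: "m1 \<in> S" "m2 \<in> S" "restrict (L m1) V = restrict (L m2) V"
        have "L m1 v = L m2 v" for v
        proof (cases "v \<in> V")
          case True
          then show ?thesis
            using m(3) by (metis restrict_apply')
        next
          case False
          then show ?thesis
            using keys m(1,2) by (metis L_def in_keys_iff subsetD)
        qed
        then show "L m1 = L m2" by blast
      qed
      show "(\<Sum>e\<in>L ` S. c (inv L e) * (\<Prod>v\<in>V. real (x v) ^ e v)) = 0"
        if "\<And>v. 0 < x v" for x :: "'v \<Rightarrow> nat"
      proof -
        have "(\<Sum>e\<in>L ` S. c (inv L e) * (\<Prod>v\<in>V. real (x v) ^ e v)) =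
            (\<Sum>m\<in>S. c m * (\<Prod>v\<in>V. real (x v) ^ L m v))"
          using injL by (simp add: sum.reindex inj_on_subset[of L UNIV])
        also have "\<dots> = (\<Sum>m\<in>S. c m * (\<Prod>v\<in>Poly_Mapping.keys m. real (x v) ^ L m v))"
          using fin keys
          by (intro sum.cong refl arg_cong2[of _ _ _ _ "(*)"] prod.mono_neutral_right)
             (auto simp: L_def in_keys_iff)
        also have "\<dots> = peval (\<lambda>v. real (x v)) p - peval (\<lambda>v. real (x v)) q"
          unfolding id_hom.peval_via_superset[OF S(1,2)] id_hom.peval_via_superset[OF S(1,3)]
          by (simp add: c_def L_def left_diff_distrib sum_subtractf)
        finally show ?thesis
          using eq[OF that] by simp
      qed
    qed
    then show ?thesis
      using injL by simp
  qed
  show "Poly_Mapping.lookup p m = Poly_Mapping.lookup q m"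
  proof (cases "m \<in> S")
    case True
    then show ?thesis
      using c[of m] by (simp add: c_def)
  next
    case False
    then show ?thesis
      by (simp add: S_def in_keys_iff)
  qed
qed


section \<open>The blowup-polynomial\<close>

definition blowup_det_poly :: "'v set \<Rightarrow> ('v \<Rightarrow> real) \<Rightarrow> ('v \<Rightarrow> 'v \<Rightarrow> real) \<Rightarrow> 'v mpoly" where
  "blowup_det_poly V f M = det_on V (mat_plus (diag_mat (\<lambda>v. PConst (f v)))
     (mat_times V (diag_mat PVar) (\<lambda>v w. PConst (M v w))))"

text \<open>
  The principal minor expansion in the polynomial ring is already the expansion into monomials: its
  minors and diagonal products are constants, as constants embed by a ring homomorphism.
\<close>

lemma blowup_det_poly_expand:
  assumes fin: "finite V"
  shows "blowup_det_poly V f M =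
    (\<Sum>I\<in>Pow V. Poly_Mapping.single (squarefree_monomial I) (det_on I M * (\<Prod>v\<in>V - I. f v)))"
proof -
  have "(\<Prod>v\<in>I. PVar v) * (det_on I (\<lambda>v w. PConst (M v w)) * (\<Prod>v\<in>V - I. PConst (f v))) =
      Poly_Mapping.single (squarefree_monomial I) (det_on I M * (\<Prod>v\<in>V - I. f v))" for I
    unfolding PConst_hom.hom_det_on[symmetric] PConst_hom.hom_prod[symmetric]
      PConst_hom.hom_mult[symmetric]
    by (simp add: prod_PVar PConst_def mult_single)
  then show ?thesis
    by (simp add: blowup_det_poly_def det_on_diag_plus_scaled[OF fin])
qed

lemma lookup_blowup_det_poly:
  assumes fin: "finite V" and I: "I \<subseteq> V"
  shows "Poly_Mapping.lookup (blowup_det_poly V f M) (squarefree_monomial I) =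
    det_on I M * (\<Prod>v\<in>V - I. f v)"
proof -
  have "Poly_Mapping.lookup (blowup_det_poly V f M) (squarefree_monomial I) =
      (\<Sum>J\<in>Pow V. if J = I then det_on J M * (\<Prod>v\<in>V - J. f v) else 0)"
    unfolding blowup_det_poly_expand[OF fin] lookup_sum
  proof (intro sum.cong refl)
    fix J assume "J \<in> Pow V"
    then have "squarefree_monomial J = squarefree_monomial I \<longleftrightarrow> J = I"
      using fin I finite_subset squarefree_monomial_eq_iff by (metis PowD)
    then show "Poly_Mapping.lookup (Poly_Mapping.single (squarefree_monomial J)
        (det_on J M * (\<Prod>v\<in>V - J. f v))) (squarefree_monomial I) =
        (if J = I then det_on J M * (\<Prod>v\<in>V - J. f v) else 0)"
      by (auto simp: lookup_single)
  qed
  then show ?thesis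
    using fin I by simp
qed

lemma keys_blowup_det_poly:
  assumes "finite V"
  shows "Poly_Mapping.keys (blowup_det_poly V f M) \<subseteq> squarefree_monomial ` Pow V"
  unfolding blowup_det_poly_expand[OF assms]
  by (rule order_trans[OF keys_sum]) auto

lemma polynomial_in_blowup_det_poly:
  assumes "finite V"
  shows "polynomial_in V (blowup_det_poly V f M)"
proof -
  have "Poly_Mapping.keys (squarefree_monomial I) \<subseteq> V" if "I \<subseteq> V" for I
    using that assms finite_subset by (metis keys_squarefree_monomial)
  then show ?thesis
    using keys_blowup_det_poly[OF assms] unfolding polynomial_in_def by blast
qed

lemma multi_affine_blowup_det_poly:
  assumes "finite V"
  shows "multi_affine (blowup_det_poly V f M)"
proof -
  have "Poly_Mapping.lookup (squarefree_monomial I) v \<le> 1" if "I \<subseteq> V" for I v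
    using that assms finite_subset by (metis lookup_squarefree_monomial le_refl zero_le_one)
  then show ?thesis
    using keys_blowup_det_poly[OF assms] unfolding multi_affine_def by blast
qed

lemma (in real_ring_hom) peval_via_blowup_det_poly:
  assumes fin: "finite V"
  shows "peval_via h x (blowup_det_poly V f M) =
    det_on V (mat_plus (diag_mat (\<lambda>v. h (f v)))
      (mat_times V (diag_mat x) (\<lambda>v w. h (M v w))))"
  unfolding blowup_det_poly_expand[OF fin] det_on_diag_plus_scaled[OF fin] peval_via_sum
proof (intro sum.cong refl)
  fix I assume "I \<in> Pow V"
  then have I: "finite I"
    using fin finite_subset by auto
  then show "peval_via h x (Poly_Mapping.single (squarefree_monomial I)
      (det_on I M * (\<Prod>v\<in>V - I. f v))) =
      (\<Prod>v\<in>I. x v) * (det_on I (\<lambda>v w. h (M v w)) * (\<Prod>v\<in>V - I. h (f v)))"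
    by (simp add: peval_via_single keys_squarefree_monomial[OF I] hom_mult hom_det_on hom_prod
        lookup_squarefree_monomial mult.commute)
qed

text \<open>
  This is the determinant formula for blowups with every \<open>t\<close> equal to one, so that the sum of \<open>t\<close>
  over the copies of \<open>v\<close> is \<open>n v\<close>.
\<close>

lemma is_blowup_polynomial_blowup_det_poly:
  assumes fin: "finite (pverts G)"
  shows "is_blowup_polynomial G f M (blowup_det_poly (pverts G) f M)"
  unfolding is_blowup_polynomial_def
proof (intro conjI allI impI)
  show "polynomial_in (pverts G) (blowup_det_poly (pverts G) f M)"
    using fin by (rule polynomial_in_blowup_det_poly)
next
  fix n :: "'a \<Rightarrow> nat" assume pos: "\<forall>v\<in>pverts G. 0 < n v"
  define W where "W = (SIGMA v:pverts G. {1..n v})"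
  have finW: "finite W"
    using fin by (simp add: W_def)
  have "det_on (pverts (blowup G n)) (A_mat (blowup_diag f) (blowup_mat M)) =
      det_on W (mat_plus (diag_mat (\<lambda>u. f (fst u)))
        (mat_times W (diag_mat (\<lambda>_. 1)) (\<lambda>u w. M (fst u) (fst w))))"
    unfolding blowup_def pair_pre_digraph.simps W_def[symmetric]
    by (rule det_on_cong)
       (simp add: A_mat_def mat_plus_def mat_times_diag_mat[OF finW],
        simp add: diag_mat_def blowup_diag_def blowup_mat_def case_prod_unfold)
  also have "\<dots> = (\<Prod>v\<in>pverts G. f v ^ (n v - 1)) *
      det_on (pverts G) (mat_plus (diag_mat f)
        (mat_times (pverts G) (diag_mat (\<lambda>v. \<Sum>i=1..n v. 1)) M))"
    unfolding W_def using pos by (intro det_on_blowup[OF fin]) auto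
  finally show "det_on (pverts (blowup G n)) (A_mat (blowup_diag f) (blowup_mat M)) =
      (\<Prod>v\<in>pverts G. f v ^ (n v - 1)) *
      peval (\<lambda>v. real (n v)) (blowup_det_poly (pverts G) f M)"
    by (simp add: id_hom.peval_via_blowup_det_poly[OF fin])
qed

text \<open>
  Since every \<open>f v\<close> is nonzero, the prefactor can be cancelled, and the determinants then prescribe
  the values of the polynomial at all positive integer points.
\<close>

lemma is_blowup_polynomial_unique:
  assumes fin: "finite (pverts G)" and nonzero: "\<forall>v\<in>pverts G. f v \<noteq> 0"
    and p: "is_blowup_polynomial G f M p" and q: "is_blowup_polynomial G f M q"
  shows "p = q"
proof (rule polynomial_eqI_positive_integers[OF fin])
  show "polynomial_in (pverts G) p" "polynomial_in (pverts G) q"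
    using p q by (simp_all add: is_blowup_polynomial_def)
  fix n :: "'a \<Rightarrow> nat" assume "\<And>v. 0 < n v"
  then have "(\<Prod>v\<in>pverts G. f v ^ (n v - 1)) * peval (\<lambda>v. real (n v)) p =
      (\<Prod>v\<in>pverts G. f v ^ (n v - 1)) * peval (\<lambda>v. real (n v)) q"
    using p q by (simp add: is_blowup_polynomial_def)
  moreover have "(\<Prod>v\<in>pverts G. f v ^ (n v - 1)) \<noteq> 0"
    using fin nonzero by simp
  ultimately show "peval (\<lambda>v. real (n v)) p = peval (\<lambda>v. real (n v)) q"
    by simp
qed

lemma ex1_is_blowup_polynomial:
  assumes "finite (pverts G)" "\<forall>v\<in>pverts G. f v \<noteq> 0"
  shows "\<exists>!q. is_blowup_polynomial G f M q"
  using is_blowup_polynomial_blowup_det_poly[OF assms(1)] is_blowup_polynomial_unique[OF assms]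
  by blast

lemma blowup_polynomial_eq_det:
  assumes "finite (pverts G)" "\<forall>v\<in>pverts G. f v \<noteq> 0"
  shows "blowup_polynomial G f M = blowup_det_poly (pverts G) f M"
  unfolding blowup_polynomial_def
  using ex1_is_blowup_polynomial[OF assms] is_blowup_polynomial_blowup_det_poly[OF assms(1)]
  by (rule the1_equality)

text \<open>
  Here the determinant formula for blowups is used inside the polynomial ring, with the variables of
  the blowup as \<open>t\<close>; substituting into the polynomial of \<open>G\<close> amounts to substituting into the
  entries of its matrix.
\<close>

lemma blowup_det_poly_blowup:
  assumes fin: "finite (pverts G)" and pos: "\<forall>v\<in>pverts G. 0 < n v"
  shows "blowup_det_poly (pverts (blowup G n)) (blowup_diag f) (blowup_mat M) =
    psubst (\<lambda>v. \<Sum>i=1..n v. PVar (v, i)) (blowup_det_poly (pverts G) f M) *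
      PConst (\<Prod>v\<in>pverts G. f v ^ (n v - 1))"
proof -
  have "blowup_det_poly (pverts (blowup G n)) (blowup_diag f) (blowup_mat M) =
      (\<Prod>v\<in>pverts G. PConst (f v) ^ (n v - 1)) *
        det_on (pverts G) (mat_plus (diag_mat (\<lambda>v. PConst (f v)))
          (mat_times (pverts G) (diag_mat (\<lambda>v. \<Sum>i=1..n v. PVar (v, i)))
            (\<lambda>v w. PConst (M v w))))"
    unfolding blowup_det_poly_def blowup_def pair_pre_digraph.simps blowup_diag_def
      blowup_mat_def case_prod_unfold
    using pos
    by (intro det_on_blowup[OF fin, where d = "\<lambda>v. PConst (f v)" and t = PVar
        and A = "\<lambda>v w. PConst (M v w)"]) auto
  then show ?thesis
    by (simp add: PConst_hom.peval_via_blowup_det_poly[OF fin] PConst_hom.hom_prod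
        PConst_hom.hom_power mult.commute)
qed


section \<open>Constant and linear terms\<close>

lemma peval_homogeneous_part_1_blowup_det_poly:
  assumes fin: "finite V"
  shows "peval x (homogeneous_part 1 (blowup_det_poly V f M)) =
    (\<Sum>v\<in>V. M v v * (\<Prod>w\<in>V - {v}. f w) * x v)"
proof -
  define p where "p = blowup_det_poly V f M"
  define F where "F m = Poly_Mapping.lookup p m *
    (\<Prod>v\<in>Poly_Mapping.keys m. x v ^ Poly_Mapping.lookup m v)" for m
  let ?e = "\<lambda>v. squarefree_monomial {v}"
  let ?S = "{m \<in> Poly_Mapping.keys p.
    (\<Sum>v\<in>Poly_Mapping.keys m. Poly_Mapping.lookup m v) = 1}"
  have "?S \<subseteq> ?e ` V"
  proof
    fix m assume m: "m \<in> ?S"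
    then obtain I where I: "I \<subseteq> V" "m = squarefree_monomial I"
      using keys_blowup_det_poly[OF fin] p_def by blast
    then have "finite I"
      using fin finite_subset by blast
    then have "card I = 1"
      using m degree_squarefree_monomial[of I] I(2) by simp
    then show "m \<in> ?e ` V"
      using I by (auto simp: card_1_singleton_iff)
  qed
  (* a monomial ?e v can have coefficient zero, and then it is absent from ?S *)
  moreover have "?e ` V - ?S \<subseteq> {m. F m = 0}"
    by (auto simp: F_def in_keys_iff degree_squarefree_monomial)
  ultimately have "(\<Sum>m\<in>?S. F m) = (\<Sum>m\<in>?e ` V. F m)"
    using fin by (intro sum.mono_neutral_left) auto
  also have "\<dots> = (\<Sum>v\<in>V. F (?e v))"
    by (intro sum.reindex_cong[of ?e]) (auto simp: inj_on_def squarefree_monomial_eq_iff)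
  also have "\<dots> = (\<Sum>v\<in>V. M v v * (\<Prod>w\<in>V - {v}. f w) * x v)"
  proof (rule sum.cong[OF refl])
    fix v assume "v \<in> V"
    moreover have "det_on {v} M = M v v"
      by (simp add: det_on_def)
    ultimately show "F (?e v) = M v v * (\<Prod>w\<in>V - {v}. f w) * x v"
      using fin by (simp add: F_def p_def lookup_blowup_det_poly keys_squarefree_monomial
          lookup_squarefree_monomial)
  qed
  finally show ?thesis
    by (simp add: homogeneous_part_def id_hom.peval_via_sum id_hom.peval_via_single F_def p_def)
qed

text \<open>
  On the \<open>w\<close>-axis only the monomials of \<open>{}\<close> and \<open>{w}\<close> survive, so the polynomial is affine there.
\<close>

lemma partial_deriv_blowup_det_poly_0:
  assumes fin: "finite V" and w: "w \<in> V"
  shows "partial_deriv w (\<lambda>y. peval y (blowup_det_poly V f M)) (\<lambda>_. 0) =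
    M w w * (\<Prod>v\<in>V - {w}. f v)"
proof -
  define c where "c I = det_on I M * (\<Prod>v\<in>V - I. f v)" for I
  have "peval ((\<lambda>_. 0)(w := s)) (blowup_det_poly V f M) = c {} + c {w} * s" for s
  proof -
    have "peval ((\<lambda>_. 0)(w := s)) (blowup_det_poly V f M) =
        (\<Sum>I\<in>Pow V. (\<Prod>v\<in>I. ((\<lambda>_. 0)(w := s)) v) * c I)"
      unfolding id_hom.peval_via_blowup_det_poly[OF fin] det_on_diag_plus_scaled[OF fin] c_def ..
    also have "\<dots> = (\<Sum>I\<in>{{}, {w}}. (\<Prod>v\<in>I. ((\<lambda>_. 0)(w := s)) v) * c I)"
    proof (rule sum.mono_neutral_right)
      show "\<forall>I\<in>Pow V - {{}, {w}}. (\<Prod>v\<in>I. ((\<lambda>_. 0)(w := s)) v) * c I = 0"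
      proof
        fix I assume I: "I \<in> Pow V - {{}, {w}}"
        then obtain v where "v \<in> I" "v \<noteq> w" by blast
        moreover have "finite I"
          using I fin finite_subset by auto
        ultimately have "(\<Prod>v\<in>I. ((\<lambda>_. 0)(w := s)) v) = 0"
          by (intro prod_zero bexI[of _ v]) auto
        then show "(\<Prod>v\<in>I. ((\<lambda>_. 0)(w := s)) v) * c I = 0" by simp
      qed
    qed (use fin w in auto)
    finally show ?thesis by (simp add: mult.commute)
  qed
  moreover have "deriv (\<lambda>s. c {} + c {w} * s) 0 = c {w}"
    by (rule DERIV_imp_deriv) (auto intro!: derivative_eq_intros)
  moreover have "det_on {w} M = M w w"
    by (simp add: det_on_def)
  ultimately show ?thesis
    by (simp add: partial_deriv_def c_def)
qed

theorem theorem2p1: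
  fixes G :: "'a pair_pre_digraph"
    and f :: "'a \<Rightarrow> real"
    and M :: "'a \<Rightarrow> 'a \<Rightarrow> real"
  defines "V \<equiv> pverts G"
    and "p \<equiv> blowup_polynomial G f M"
  assumes graph: "pair_graph G"
    and conn: "Digraph_Component.connected (with_proj G)"
    and sym: "\<forall>v\<in>V. \<forall>w\<in>V. M v w = M w v"
    and nonzero: "\<forall>v\<in>V. f v \<noteq> 0"
  shows
    "(\<exists>!q. is_blowup_polynomial G f M q) \<and>
     is_blowup_polynomial G f M p \<and>
     (p = det_on V (mat_plus (diag_mat (\<lambda>v. PConst (f v)))
           (mat_times V (diag_mat PVar) (\<lambda>v w. PConst (M v w))))) \<and>
     (\<forall>x. peval x p = det_on V (mat_plus (diag_mat f) (mat_times V (diag_mat x) M))) \<and>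
     multi_affine p \<and>
     (coefficient p 0 = peval (\<lambda>_. 0) p) \<and>
     (peval (\<lambda>_. 0) p = det_on V (diag_mat f)) \<and>
     (det_on V (diag_mat f) = (\<Prod>v\<in>V. f v)) \<and>
     (\<forall>x. peval x (homogeneous_part 1 p) =
           (\<Sum>v\<in>V. 1 * (\<Sum>w\<in>V. diag_mat x v w * partial_deriv w (\<lambda>y. peval y p) (\<lambda>_. 0)))) \<and>
     (\<forall>x. (\<Sum>v\<in>V. 1 * (\<Sum>w\<in>V. diag_mat x v w * partial_deriv w (\<lambda>y. peval y p) (\<lambda>_. 0))) =
           peval (\<lambda>_. 0) p * (\<Sum>v\<in>V. M v v / f v * x v)) \<and>
     (\<forall>I\<subseteq>V. coefficient p (squarefree_monomial I) = det_on I M * (\<Prod>v\<in>V - I. f v)) \<and>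
     (\<forall>n. (\<forall>v\<in>V. 0 < n v) \<longrightarrow>
       (\<exists>!q. is_blowup_polynomial (blowup G n) (blowup_diag f) (blowup_mat M) q) \<and>
       blowup_polynomial (blowup G n) (blowup_diag f) (blowup_mat M) =
         psubst (\<lambda>v. \<Sum>i=1..n v. PVar (v, i)) p * PConst (\<Prod>v\<in>V. f v ^ (n v - 1)))"
proof -
  interpret pair_graph G by fact
  have fin: "finite V"
    using pair_finite_verts by (simp add: V_def)
  have p: "p = blowup_det_poly V f M"
    using fin nonzero unfolding p_def V_def by (rule blowup_polynomial_eq_det)
  have det_diag: "det_on V (diag_mat f) = (\<Prod>v\<in>V. f v)"
    using fin by (rule det_on_diag_mat)
  have eval0: "peval (\<lambda>_. 0) p = det_on V (diag_mat f)"
    unfolding p id_hom.peval_via_blowup_det_poly[OF fin]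
    by (rule det_on_cong) (simp add: mat_plus_def mat_times_diag_mat[OF fin])
  have coeff: "coefficient p (squarefree_monomial I) = det_on I M * (\<Prod>v\<in>V - I. f v)"
    if "I \<subseteq> V" for I
    unfolding p using fin that by (rule lookup_blowup_det_poly)
  have coeff0: "coefficient p 0 = (\<Prod>v\<in>V. f v)"
    using coeff[of "{}"] by (simp add: squarefree_monomial_def det_on_empty)
  have gradient: "(\<Sum>v\<in>V. 1 * (\<Sum>w\<in>V.
      diag_mat x v w * partial_deriv w (\<lambda>y. peval y p) (\<lambda>_. 0))) =
      (\<Sum>v\<in>V. M v v * (\<Prod>w\<in>V - {v}. f w) * x v)" for x
  proof (rule sum.cong[OF refl])
    fix v assume v: "v \<in> V"
    have "(\<Sum>w\<in>V. diag_mat x v w * partial_deriv w (\<lambda>y. peval y p) (\<lambda>_. 0)) =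
        (\<Sum>w\<in>V. if v = w then x w * partial_deriv w (\<lambda>y. peval y p) (\<lambda>_. 0) else 0)"
      by (intro sum.cong) (auto simp: diag_mat_def)
    then show "1 * (\<Sum>w\<in>V. diag_mat x v w * partial_deriv w (\<lambda>y. peval y p) (\<lambda>_. 0)) =
        M v v * (\<Prod>w\<in>V - {v}. f w) * x v"
      using fin v by (simp add: p partial_deriv_blowup_det_poly_0 mult.commute)
  qed
  have linear: "(\<Sum>v\<in>V. M v v * (\<Prod>w\<in>V - {v}. f w) * x v) =
      (\<Prod>v\<in>V. f v) * (\<Sum>v\<in>V. M v v / f v * x v)" for x
    unfolding sum_distrib_left
  proof (rule sum.cong[OF refl])
    fix v assume v: "v \<in> V"
    then show "M v v * (\<Prod>w\<in>V - {v}. f w) * x v = (\<Prod>v\<in>V. f v) * (M v v / f v * x v)"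
      using nonzero by (simp add: prod.remove[OF fin v])
  qed
  have blowup: "(\<exists>!q. is_blowup_polynomial (blowup G n) (blowup_diag f) (blowup_mat M) q) \<and>
      blowup_polynomial (blowup G n) (blowup_diag f) (blowup_mat M) =
        psubst (\<lambda>v. \<Sum>i=1..n v. PVar (v, i)) p * PConst (\<Prod>v\<in>V. f v ^ (n v - 1))"
    if pos: "\<forall>v\<in>V. 0 < n v" for n
  proof -
    have finW: "finite (pverts (blowup G n))"
      using fin by (simp add: blowup_def V_def)
    have nonzeroW: "\<forall>u\<in>pverts (blowup G n). blowup_diag f u \<noteq> 0"
      using nonzero by (auto simp: blowup_def blowup_diag_def V_def)
    show ?thesis
      using ex1_is_blowup_polynomial[OF finW nonzeroW]
        blowup_polynomial_eq_det[OF finW nonzeroW]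
        blowup_det_poly_blowup[OF fin[unfolded V_def] pos[unfolded V_def], of f M]
      by (simp add: p V_def)
  qed
  show ?thesis
    using ex1_is_blowup_polynomial[of G f M] is_blowup_polynomial_blowup_det_poly[of G f M]
      fin nonzero coeff coeff0 eval0 det_diag gradient linear blowup
      multi_affine_blowup_det_poly[OF fin, of f M]
      id_hom.peval_via_blowup_det_poly[OF fin, of _ f M]
      peval_homogeneous_part_1_blowup_det_poly[OF fin, of _ f M]
    by (auto simp: p blowup_det_poly_def V_def)
qed

end
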